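(* Let $N\ge1$, $d\ge2$, $\boldsymbol p=(p_1,\dots,p_d)$ with $p_j>0$, $\sum_jp_j=1$, and let $p\in(0,1)$, $q=1-p$, be a parameter not depending on $\boldsymbol p$. Define $$K(\boldsymbol x,\boldsymbol y,z)=\sum_{n=0}^NQ_n(z;N,p)\,Q_n(\boldsymbol x,\boldsymbol y;N,\boldsymbol p),$$ where $Q_n(z;N,p)$ are the one-dimensional Krawtchouk polynomials and $Q_n(\boldsymbol x,\boldsymbol y;N,\boldsymbol p)$ the reproducing kernel polynomials on the multinomial $(N,\boldsymbol p)$ distribution. (a) $K(\boldsymbol x,\boldsymbol y,z)\ge0$ for all $\boldsymbol x,\boldsymbol y$ in the support of the multinomial $(N,\boldsymbol p)$ distribution and all $z=0,1,\dots,N$ if and only if $$1-p\le\min_{j\in\{1,\dots,d\}}p_j.$$ (b) If $1-p\le\min_jp_j$, there is a duplication formula: for $n=0,\dots,N$ and all $\boldsymbol x,\boldsymbol y$ in the support, $$Q_n(\boldsymbol x,\boldsymbol y;N,\boldsymbol p)=h_n(p)\,\mathbb E_{\varphi_{\boldsymbol x,\boldsymbol y}}\big[Q_n(Z;N,p)\big],\qquad h_n(p)=\binom Nn(p/q)^n,$$ where $Z$ has the probability distribution $$\varphi_{\boldsymbol x,\boldsymbol y}(z)=\binom Nzp^zq^{N-z}K(\boldsymbol x,\boldsymbol y,z),\qquad z=0,1,\dots,N.$$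
   Context: The one-dimensional Krawtchouk polynomials, orthogonal on the binomial $(N,p)$ distribution and scaled so $Q_n(0;N,p)=1$, are $Q_n(x;N,p)=\sum_{\nu}(-q/p)^\nu\binom x\nu\binom{N-x}{n-\nu}\big/\binom Nn$, $q=1-p$; they satisfy $\mathbb E[Q_n(X)Q_m(X)]=\delta_{nm}h_n(p)^{-1}$ for $X$ binomial $(N,p)$. Reproducing kernel polynomials: the multinomial $(N,\boldsymbol p)$ distribution has probabilities $m(\boldsymbol x;N,\boldsymbol p)=\frac{N!}{\prod_jx_j!}\prod_jp_j^{x_j}$ on $\{\boldsymbol x\in\mathbb Z_+^d:|\boldsymbol x|=N\}$, $|\boldsymbol x|=\sum_jx_j$. Choose real functions $u^{(0)}\equiv1,u^{(1)},\dots,u^{(d-1)}$ on $\{1,\dots,d\}$ with $\sum_{j=1}^du^{(k)}_ju^{(l)}_jp_j=\delta_{kl}$. For $\boldsymbol n\in\mathbb Z_+^{d-1}$, $|\boldsymbol n|\le N$, let $Q_{\boldsymbol n}(\boldsymbol x;\boldsymbol u)$ be the coefficient of $w_1^{n_1}\cdots w_{d-1}^{n_{d-1}}$ in $\prod_{j=1}^d\big(1+\sum_{l=1}^{d-1}w_lu^{(l)}_j\big)^{x_j}$. These are orthogonal on the multinomial with squared norm $\frac{N!}{n_1!\cdots n_{d-1}!(N-|\boldsymbol n|)!}$; let $Q^\circ_{\boldsymbol n}$ be their normalizations to unit norm. Then $Q_n(\boldsymbol x,\boldsymbol y;N,\boldsymbol p)=\sum_{|\boldsymbol n|=n}Q^\circ_{\boldsymbol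 n}(\boldsymbol x;\boldsymbol u)Q^\circ_{\boldsymbol n}(\boldsymbol y;\boldsymbol u)$, independent of the choice of $\boldsymbol u$. *)

theory Defs
  imports "HOL-Probability.Probability" "HOL-Library.Poly_Mapping"
begin

text \<open>
  Coordinates \<open>j\<close> of points of the multinomial range over \<open>{1..d}\<close>, and indices of the indeterminates
  \<open>w\<^sub>1, \<dots>, w\<^sub>d\<^sub>-\<^sub>1\<close> over \<open>{1..<d}\<close>. The real parameter is written \<open>p\<close> and the probability
  vector \<open>P\<close>.
\<close>

definition krawtchouk :: "nat \<Rightarrow> real \<Rightarrow> nat \<Rightarrow> nat \<Rightarrow> real" where
  "krawtchouk N p n x =
     (\<Sum>\<nu>\<le>n. (- ((1 - p) / p)) ^ \<nu> * real (x choose \<nu>) * real ((N - x) choose (n - \<nu>)))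
       / real (N choose n)"

definition krawtchouk_h :: "nat \<Rightarrow> real \<Rightarrow> nat \<Rightarrow> real" where
  "krawtchouk_h N p n = real (N choose n) * (p / (1 - p)) ^ n"

text \<open>Coordinates outside \<open>{1..d}\<close> are set to zero, so that each point is represented once.\<close>

definition multinomial_support :: "nat \<Rightarrow> nat \<Rightarrow> (nat \<Rightarrow> nat) set" where
  "multinomial_support N d = {x. (\<forall>j. j \<notin> {1..d} \<longrightarrow> x j = 0) \<and> (\<Sum>j=1..d. x j) = N}"

definition multinomial_mass :: "nat \<Rightarrow> nat \<Rightarrow> (nat \<Rightarrow> real) \<Rightarrow> (nat \<Rightarrow> nat) \<Rightarrow> real" where
  "multinomial_mass N d P x = fact N / (\<Prod>j=1..d. fact (x j)) * (\<Prod>j=1..d. P j ^ x j)"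

definition orthonormal_functions :: "nat \<Rightarrow> (nat \<Rightarrow> real) \<Rightarrow> (nat \<Rightarrow> nat \<Rightarrow> real) \<Rightarrow> bool" where
  "orthonormal_functions d P u \<longleftrightarrow>
     (\<forall>j\<in>{1..d}. u 0 j = 1) \<and>
     (\<forall>k<d. \<forall>l<d. (\<Sum>j=1..d. u k j * u l j * P j) = (if k = l then 1 else 0))"

text \<open>
  Multivariate polynomials are finitely supported maps from monomials (exponent vectors
  \<open>nat \<Rightarrow>\<^sub>0 nat\<close>) to coefficients; their product is the convolution of \<open>Poly_Mapping\<close>.
\<close>

type_synonym mpoly = "(nat \<Rightarrow>\<^sub>0 nat) \<Rightarrow>\<^sub>0 real"

definition mvar :: "nat \<Rightarrow> mpoly" where
  "mvar l = Poly_Mapping.single (Poly_Mapping.single l 1) 1"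

definition mconst :: "real \<Rightarrow> mpoly" where
  "mconst c = Poly_Mapping.single 0 c"

definition multi_krawtchouk ::
    "nat \<Rightarrow> (nat \<Rightarrow> nat \<Rightarrow> real) \<Rightarrow> (nat \<Rightarrow>\<^sub>0 nat) \<Rightarrow> (nat \<Rightarrow> nat) \<Rightarrow> real" where
  "multi_krawtchouk d u m x =
     Poly_Mapping.lookup (\<Prod>j=1..d. (1 + (\<Sum>l\<in>{1..<d}. mvar l * mconst (u l j))) ^ x j) m"

definition multi_krawtchouk_normalized ::
    "nat \<Rightarrow> nat \<Rightarrow> (nat \<Rightarrow> real) \<Rightarrow> (nat \<Rightarrow> nat \<Rightarrow> real) \<Rightarrow> (nat \<Rightarrow>\<^sub>0 nat) \<Rightarrow> (nat \<Rightarrow> nat) \<Rightarrow> real" where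
  "multi_krawtchouk_normalized N d P u m x =
     multi_krawtchouk d u m x /
       sqrt (\<Sum>y\<in>multinomial_support N d. multinomial_mass N d P y * (multi_krawtchouk d u m y)\<^sup>2)"

definition multi_degrees :: "nat \<Rightarrow> nat \<Rightarrow> (nat \<Rightarrow>\<^sub>0 nat) set" where
  "multi_degrees d n =
     {m. Poly_Mapping.keys m \<subseteq> {1..<d} \<and> (\<Sum>l\<in>{1..<d}. Poly_Mapping.lookup m l) = n}"

definition reproducing_kernel ::
    "nat \<Rightarrow> nat \<Rightarrow> (nat \<Rightarrow> real) \<Rightarrow> (nat \<Rightarrow> nat \<Rightarrow> real) \<Rightarrow> nat \<Rightarrow> (nat \<Rightarrow> nat) \<Rightarrow> (nat \<Rightarrow> nat) \<Rightarrow> real" where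
  "reproducing_kernel N d P u n x y =
     (\<Sum>m\<in>multi_degrees d n.
        multi_krawtchouk_normalized N d P u m x * multi_krawtchouk_normalized N d P u m y)"

definition triple_kernel ::
    "nat \<Rightarrow> nat \<Rightarrow> real \<Rightarrow> (nat \<Rightarrow> real) \<Rightarrow> (nat \<Rightarrow> nat \<Rightarrow> real) \<Rightarrow> (nat \<Rightarrow> nat) \<Rightarrow> (nat \<Rightarrow> nat) \<Rightarrow> nat \<Rightarrow> real"
  where
  "triple_kernel N d p P u x y z =
     (\<Sum>n=0..N. krawtchouk N p n z * reproducing_kernel N d P u n x y)"

text \<open>
  Statements about the reproducing kernel quantify over all admissible \<open>u\<close>. They are not
  vacuous: functions of Helmert type are admissible for every positive probability vector.
\<close>

lemma orthonormal_functions_exist: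
  fixes P :: "nat \<Rightarrow> real"
  assumes pos: "\<And>j. j \<in> {1..d} \<Longrightarrow> P j > 0" and sum1: "(\<Sum>j=1..d. P j) = 1"
  shows "\<exists>u. orthonormal_functions d P u"
proof -
  define S where "S k = (\<Sum>j=1..k. P j)" for k
  define D where "D k = sqrt (P (Suc k) * S k * S (Suc k))" for k
  define u where "u k j =
    (if k = 0 then 1
     else (if j \<le> k then P (Suc k) else if j = Suc k then - S k else 0) / D k)" for k j :: nat
  have S_pos: "S k > 0" if "1 \<le> k" "k \<le> d" for k
    unfolding S_def using that by (intro sum_pos) (auto intro!: pos)
  have D2: "D k * D k = P (Suc k) * S k * S (Suc k)" "D k > 0" if "1 \<le> k" "k < d" for k
  proof -
    have "P (Suc k) * S k * S (Suc k) > 0"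
      using that by (intro mult_pos_pos S_pos pos) auto
    then show "D k * D k = P (Suc k) * S k * S (Suc k)" "D k > 0"
      by (simp_all add: D_def)
  qed
  have split: "(\<Sum>j=1..d. f j) = (\<Sum>j=1..k. f j) + f (Suc k)"
    if "1 \<le> k" "k < d" "\<And>j. j > Suc k \<Longrightarrow> f j = 0" for k and f :: "nat \<Rightarrow> real"
  proof -
    have "(\<Sum>j=1..d. f j) = (\<Sum>j=1..Suc k. f j)"
      using that by (intro sum.mono_neutral_right) auto
    then show ?thesis by simp
  qed
  have mean0: "(\<Sum>j=1..d. u k j * P j) = 0" if k: "1 \<le> k" "k < d" for k
  proof -
    have "(\<Sum>j=1..d. u k j * P j) = (\<Sum>j=1..k. u k j * P j) + u k (Suc k) * P (Suc k)"
      using k by (intro split) (auto simp: u_def)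
    also have "(\<Sum>j=1..k. u k j * P j) = (\<Sum>j=1..k. P (Suc k) / D k * P j)"
      using k by (intro sum.cong) (auto simp: u_def)
    also have "\<dots> = P (Suc k) / D k * S k"
      by (simp add: S_def sum_distrib_left)
    finally show ?thesis using k by (simp add: u_def)
  qed
  have norm1: "(\<Sum>j=1..d. u k j * u k j * P j) = 1" if k: "1 \<le> k" "k < d" for k
  proof -
    have "(\<Sum>j=1..d. u k j * u k j * P j)
        = (\<Sum>j=1..k. u k j * u k j * P j) + u k (Suc k) * u k (Suc k) * P (Suc k)"
      using k by (intro split) (auto simp: u_def)
    also have "(\<Sum>j=1..k. u k j * u k j * P j) = (\<Sum>j=1..k. P (Suc k) * P (Suc k) / (D k * D k) * P j)"
      using k by (intro sum.cong) (auto simp: u_def)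
    also have "\<dots> = P (Suc k) * P (Suc k) / (D k * D k) * S k"
      by (simp add: S_def sum_distrib_left)
    also have "\<dots> + u k (Suc k) * u k (Suc k) * P (Suc k)
        = P (Suc k) * S k * (S k + P (Suc k)) / (D k * D k)"
      using k by (simp add: u_def field_simps add_divide_distrib)
    also have "S k + P (Suc k) = S (Suc k)"
      by (simp add: S_def)
    also have "P (Suc k) * S k * S (Suc k) / (D k * D k) = 1"
      using D2[OF k] by (metis divide_self_if mult_pos_pos less_irrefl)
    finally show ?thesis .
  qed
  have orth: "(\<Sum>j=1..d. u k j * u l j * P j) = 0" if kl: "k < l" "l < d" for k l
  proof (cases "k = 0")
    case True
    then show ?thesis using mean0[of l] kl by (simp add: u_def[of 0])
  next
    case False
    have "(\<Sum>j=1..d. u k j * u l j * P j) = (\<Sum>j=1..d. P (Suc l) / D l * (u k j * P j))"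
      using False kl by (intro sum.cong) (auto simp: u_def mult_ac)
    also have "\<dots> = P (Suc l) / D l * (\<Sum>j=1..d. u k j * P j)"
      by (simp only: sum_distrib_left)
    finally show ?thesis using mean0[of k] False kl by simp
  qed
  have "(\<Sum>j=1..d. u k j * u l j * P j) = (if k = l then 1 else 0)" if "k < d" "l < d" for k l
  proof (cases k l rule: linorder_cases)
    case less
    then show ?thesis using orth that by simp
  next
    case equal
    then show ?thesis using norm1[of l] that sum1 by (cases "l = 0") (simp_all add: u_def[of 0])
  next
    case greater
    then show ?thesis using orth[of l k] that by (simp add: mult.commute)
  qed
  then have "orthonormal_functions d P u"
    by (simp add: orthonormal_functions_def u_def)
  then show ?thesis by blast
qed

end

theory Submission
  imports Defs "HOL-Combinatorics.Multiset_Permutations" "Jordan_Normal_Form.Determinant"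
begin

text \<open>
  A point of the multinomial range is the vector of letter counts of a word
  \<open>J : {..<N} \<rightarrow> {1..d}\<close>, and a multivariate Krawtchouk polynomial is the symmetrization of the
  product functions \<open>J \<mapsto> \<Prod>\<^sub>i u (k i) (J i)\<close>, which are orthonormal for \<open>N\<close> independent letters. Hence
  the reproducing kernel of degree \<open>n\<close> at \<open>(x, y)\<close> is the average, over the words \<open>J'\<close> with letter
  counts \<open>y\<close>, of the elementary symmetric polynomial \<open>e\<^sub>n\<close> in the \<open>N\<close> numbers \<open>\<xi>\<^sub>i - 1\<close>, where
  \<open>\<xi>\<^sub>i = [J i = J' i] / P (J i)\<close>. The one-dimensional polynomial at \<open>z\<close> is likewise an average of
  \<open>(-q/p)\<close> to the power \<open>\<bar>A \<inter> S\<bar>\<close> over \<open>z\<close>-subsets \<open>S\<close> of the positions, with \<open>\<bar>A\<bar> = n\<close>.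
  Summing over \<open>n\<close> factorizes: the triple kernel is the average over \<open>J'\<close> and \<open>S\<close> of
  \<open>\<Prod>\<^sub>i\<^sub>\<in>\<^sub>S (1 - q \<xi>\<^sub>i) / p \<cdot> \<Prod>\<^sub>i\<^sub>\<notin>\<^sub>S \<xi>\<^sub>i\<close>. All factors are nonnegative if \<open>q \<le> P j\<close> for all \<open>j\<close>, and if
  \<open>q > P j\<close> the kernel is negative for \<open>x = y = N e\<^sub>j\<close> and \<open>z = 1\<close>. The duplication formula is the
  orthogonality of the one-dimensional polynomials.
\<close>

subsection \<open>Words and letter counts\<close>

definition words :: "nat \<Rightarrow> nat set \<Rightarrow> (nat \<Rightarrow> nat) set" where
  "words N A = PiE {..<N} (\<lambda>_. A)"

definition letter_count :: "nat \<Rightarrow> (nat \<Rightarrow> nat) \<Rightarrow> nat \<Rightarrow> nat" where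
  "letter_count N J j = card {i\<in>{..<N}. J i = j}"

text \<open>The letter \<open>0\<close>, which stands for the constant function, contributes no indeterminate.\<close>

definition word_exponent :: "nat \<Rightarrow> (nat \<Rightarrow> nat) \<Rightarrow> nat \<Rightarrow>\<^sub>0 nat" where
  "word_exponent N k = (\<Sum>i<N. if k i = 0 then 0 else Poly_Mapping.single (k i) 1)"

lemma finite_words [simp]: "finite A \<Longrightarrow> finite (words N A)"
  unfolding words_def by (intro finite_PiE) auto

lemma wordsD: "J \<in> words N A \<Longrightarrow> i < N \<Longrightarrow> J i \<in> A"
  unfolding words_def by auto

lemma lookup_word_exponent:
  "Poly_Mapping.lookup (word_exponent N k) l = (if l = 0 then 0 else letter_count N k l)"
proof -
  have "Poly_Mapping.lookup (word_exponent N k) l = (\<Sum>i<N. if l \<noteq> 0 \<and> k i = l then 1 else 0)"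
    unfolding word_exponent_def lookup_sum by (intro sum.cong) (auto simp: lookup_single when_def)
  also have "\<dots> = (if l = 0 then 0 else letter_count N k l)"
    by (auto simp: letter_count_def sum.If_cases Int_def)
  finally show ?thesis .
qed

lemma sum_letter_count:
  assumes "J \<in> words N A" "finite A"
  shows "(\<Sum>j\<in>A. letter_count N J j) = N"
proof -
  have "(\<Sum>j\<in>A. \<Sum>i\<in>{i\<in>{..<N}. J i = j}. 1) = (\<Sum>i<N. 1::nat)"
    using assms by (intro sum.group) (auto dest: wordsD)
  then show ?thesis by (simp add: letter_count_def)
qed

text \<open>Stated for a general commutative monoid because it is applied both to the generating
  polynomial and to the probabilities \<open>P\<close>.\<close>

lemma prod_power_letter_count:
  fixes F :: "nat \<Rightarrow> 'a :: comm_monoid_mult"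
  assumes "J \<in> words N A" "finite A"
  shows "(\<Prod>j\<in>A. F j ^ letter_count N J j) = (\<Prod>i<N. F (J i))"
proof -
  have "(\<Prod>j\<in>A. \<Prod>i\<in>{i\<in>{..<N}. J i = j}. F (J i)) = (\<Prod>i<N. F (J i))"
    using assms by (intro prod.group) (auto dest: wordsD)
  moreover have "(\<Prod>i\<in>{i\<in>{..<N}. J i = j}. F (J i)) = F j ^ letter_count N J j" for j
    by (simp add: letter_count_def)
  ultimately show ?thesis by simp
qed

lemma prod_single:
  fixes b :: "'i \<Rightarrow> real" and a :: "'i \<Rightarrow> nat \<Rightarrow>\<^sub>0 nat"
  shows "(\<Prod>i\<in>I. Poly_Mapping.single (a i) (b i))
       = Poly_Mapping.single (\<Sum>i\<in>I. a i) (\<Prod>i\<in>I. b i)"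
  by (induction I rule: infinite_finite_induct) (simp_all add: mult_single)

lemma letter_count_in_support:
  assumes "J \<in> words N {1..d}"
  shows "letter_count N J \<in> multinomial_support N d"
proof -
  have "letter_count N J j = 0" if "j \<notin> {1..d}" for j
    using assms that by (auto simp: letter_count_def dest!: wordsD)
  then show ?thesis
    using sum_letter_count[OF assms] by (simp add: multinomial_support_def)
qed

lemma finite_multinomial_support: "finite (multinomial_support N d)"
proof (rule finite_subset)
  show "multinomial_support N d \<subseteq> {x. \<forall>j. (j \<in> {1..d} \<longrightarrow> x j \<in> {..N}) \<and> (j \<notin> {1..d} \<longrightarrow> x j = 0)}"
    unfolding multinomial_support_def by (auto intro: member_le_sum)
qed (intro finite_set_of_finite_funs; simp)

lemma finite_multi_degrees: "finite (multi_degrees d n)"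
proof -
  let ?F = "{f. \<forall>l. (l \<in> {1..<d} \<longrightarrow> f l \<in> {..n}) \<and> (l \<notin> {1..<d} \<longrightarrow> f l = 0)}"
  have "Poly_Mapping.lookup ` multi_degrees d n \<subseteq> ?F"
    unfolding multi_degrees_def
    by (auto simp: in_keys_iff intro: member_le_sum)
  moreover have "finite ?F" by (intro finite_set_of_finite_funs; simp)
  ultimately have "finite (Poly_Mapping.lookup ` multi_degrees d n)"
    by (rule finite_subset)
  then show ?thesis by (rule finite_imageD) (auto intro: inj_onI simp: poly_mapping.lookup_inject)
qed

text \<open>Multiplying out the generating product position by position selects one letter
  \<open>k i < d\<close> in each position \<open>i\<close>; the selections with total exponent
  \<open>m\<close> make up the coefficient.\<close>

lemma multi_krawtchouk_letter_count:
  assumes u0: "\<forall>j\<in>{1..d}. u 0 j = 1" and d: "d \<ge> 1" and J: "J \<in> words N {1..d}"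
  shows "multi_krawtchouk d u m (letter_count N J)
       = (\<Sum>k\<in>{k\<in>words N {..<d}. word_exponent N k = m}. \<Prod>i<N. u (k i) (J i))"
proof -
  let ?e = "\<lambda>l::nat. if l = 0 then 0 else Poly_Mapping.single l (1::nat)"
  \<comment> \<open>Since \<open>u 0 j = 1\<close>, the constant term is the term of the letter
    \<open>0\<close>, and each factor becomes a uniform sum over \<open>d\<close> letters.\<close>
  have factor: "1 + (\<Sum>l\<in>{1..<d}. mvar l * mconst (u l j))
      = (\<Sum>l<d. Poly_Mapping.single (?e l) (u l j))" if "j \<in> {1..d}" for j
  proof -
    have "{..<d} = insert 0 {1..<d}" using d by auto
    then have "(\<Sum>l<d. Poly_Mapping.single (?e l) (u l j))
        = Poly_Mapping.single 0 (u 0 j) + (\<Sum>l\<in>{1..<d}. Poly_Mapping.single (?e l) (u l j))"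
      by simp
    also have "\<dots> = 1 + (\<Sum>l\<in>{1..<d}. mvar l * mconst (u l j))"
      using that by (auto simp: u0 mvar_def mconst_def mult_single intro!: sum.cong)
    finally show ?thesis ..
  qed
  have "(\<Prod>j=1..d. (1 + (\<Sum>l\<in>{1..<d}. mvar l * mconst (u l j))) ^ letter_count N J j)
      = (\<Prod>i<N. 1 + (\<Sum>l\<in>{1..<d}. mvar l * mconst (u l (J i))))"
    by (rule prod_power_letter_count[OF J]) simp
  also have "\<dots> = (\<Prod>i<N. \<Sum>l<d. Poly_Mapping.single (?e l) (u l (J i)))"
    using wordsD[OF J] by (intro prod.cong refl factor) auto
  also have "\<dots> = (\<Sum>k\<in>words N {..<d}. Poly_Mapping.single (word_exponent N k) (\<Prod>i<N. u (k i) (J i)))"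
    by (simp add: prod_sum_PiE prod_single words_def word_exponent_def)
  finally show ?thesis
    unfolding multi_krawtchouk_def
    by (simp add: lookup_sum lookup_single when_def sum.inter_filter)
qed

text \<open>The exponent does not record the letter \<open>0\<close>, but its count is what the
  other counts leave of the total \<open>N\<close>.\<close>

lemma word_exponent_eq_imp_letter_count_eq:
  assumes k: "k \<in> words N {..<d}" and l: "l \<in> words N {..<d}" and d: "d \<ge> 1"
    and eq: "word_exponent N k = word_exponent N l"
  shows "letter_count N k = letter_count N l"
proof
  have pos: "letter_count N k j = letter_count N l j" if "j \<noteq> 0" for j
    using arg_cong[OF eq, of "\<lambda>f. Poly_Mapping.lookup f j"] that
    by (simp add: lookup_word_exponent)
  have ins: "{..<d} = insert 0 {1..<d}" using d by auto
  have "(\<Sum>j<d. letter_count N k j) = (\<Sum>j<d. letter_count N l j)"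
    using sum_letter_count[OF k] sum_letter_count[OF l] by simp
  moreover have "(\<Sum>j\<in>{1..<d}. letter_count N k j) = (\<Sum>j\<in>{1..<d}. letter_count N l j)"
    by (intro sum.cong) (auto simp: pos)
  ultimately have "letter_count N k 0 = letter_count N l 0" by (simp add: ins)
  with pos show "letter_count N k j = letter_count N l j" for j by (cases "j = 0") auto
qed

text \<open>Views letter counts as multiplicities, so that facts on permutations of multisets apply
  to words.\<close>

lemma count_image_mset_word:
  "count (image_mset J (mset_set {..<N})) = letter_count N J"
  by (rule ext) (auto simp: count_image_mset' letter_count_def intro!: arg_cong[where f = card])

section \<open>Words with prescribed letter counts\<close>

definition fiber :: "nat \<Rightarrow> nat \<Rightarrow> (nat \<Rightarrow> nat) \<Rightarrow> (nat \<Rightarrow> nat) set" where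
  "fiber N d y = {J\<in>words N {1..d}. letter_count N J = y}"

lemma finite_fiber [simp]: "finite (fiber N d y)"
  by (simp add: fiber_def)

text \<open>Words with equal letter counts differ by a permutation of the positions, and composition
  with it maps the fiber bijectively to itself.\<close>

lemma sum_fiber_symmetric:
  fixes u :: "nat \<Rightarrow> nat \<Rightarrow> real"
  assumes eq: "letter_count N k = letter_count N l"
  shows "(\<Sum>J\<in>fiber N d y. \<Prod>i<N. u (k i) (J i)) = (\<Sum>J\<in>fiber N d y. \<Prod>i<N. u (l i) (J i))"
proof -
  have "image_mset k (mset_set {..<N}) = image_mset l (mset_set {..<N})"
    by (simp add: multiset_eq_iff count_image_mset_word eq)
  then obtain \<pi> where pi: "\<pi> permutes {..<N}" and kl: "\<forall>i\<in>{..<N}. k i = l (\<pi> i)"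
    using image_mset_eq_implies_permutes[of "{..<N}" k l] by auto
  have mem: "J \<circ> \<sigma> \<in> fiber N d y" if J: "J \<in> fiber N d y" and sigma: "\<sigma> permutes {..<N}" for J \<sigma>
  proof -
    have "J \<circ> \<sigma> \<in> words N {1..d}"
      using J permutes_in_image[OF sigma] permutes_not_in[OF sigma]
      by (auto simp: fiber_def words_def PiE_iff extensional_def)
    moreover have "letter_count N (J \<circ> \<sigma>) = letter_count N J"
    proof -
      have "image_mset (J \<circ> \<sigma>) (mset_set {..<N}) = image_mset J (mset_set {..<N})"
        by (metis image_mset_mset_set multiset.map_comp permutes_image permutes_inj_on sigma)
      then show ?thesis by (metis count_image_mset_word)
    qed
    ultimately show ?thesis using J by (simp add: fiber_def)
  qed
  define \<tau> where "\<tau> = inv_into UNIV \<pi>"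
  have tau: "\<tau> permutes {..<N}" and tp: "\<tau> (\<pi> i) = i" and pt: "\<pi> (\<tau> i) = i" for i
    using permutes_inv[OF pi] permutes_inverses[OF pi] by (simp_all add: \<tau>_def)
  show ?thesis
  proof (rule sum.reindex_bij_witness[where i = "\<lambda>J. J \<circ> \<pi>" and j = "\<lambda>J. J \<circ> \<tau>"])
    fix J assume "J \<in> fiber N d y"
    show "(J \<circ> \<tau>) \<circ> \<pi> = J" "(J \<circ> \<pi>) \<circ> \<tau> = J"
      by (simp_all add: fun_eq_iff tp pt)
    show "J \<circ> \<tau> \<in> fiber N d y" "J \<circ> \<pi> \<in> fiber N d y"
      using \<open>J \<in> _\<close> pi tau by (auto intro!: mem)
    have "(\<Prod>i<N. u (l i) ((J \<circ> \<tau>) i)) = (\<Prod>i<N. u (l (\<pi> i)) ((J \<circ> \<tau>) (\<pi> i)))"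
      using prod.permute[OF pi, of "\<lambda>i. u (l i) ((J \<circ> \<tau>) i)"] by (simp add: o_def)
    also have "\<dots> = (\<Prod>i<N. u (k i) (J i))"
      using kl by (intro prod.cong) (auto simp: tp)
    finally show "(\<Prod>i<N. u (l i) ((J \<circ> \<tau>) i)) = (\<Prod>i<N. u (k i) (J i))" .
  qed
qed

text \<open>Read as a list, a word of the fiber is an arrangement of the multiset with
  multiplicities \<open>y\<close>; arrangements are counted by the multinomial coefficient.\<close>

lemma card_fiber:
  assumes y: "y \<in> multinomial_support N d"
  shows "real (card (fiber N d y)) = fact N / (\<Prod>j=1..d. fact (y j))"
    and "fiber N d y \<noteq> {}"
proof -
  define M where "M = Abs_multiset y"
  have fin: "finite {j. 0 < y j}"
    by (rule finite_subset[of _ "{1..d}"]) (use y in \<open>auto simp: multinomial_support_def\<close>)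
  then have cM: "count M = y" by (simp add: M_def)
  have setM: "set_mset M \<subseteq> {1..d}"
    using y cM by (auto simp: multinomial_support_def simp flip: count_greater_zero_iff)
  have sizeM: "size M = N"
  proof -
    have "size M = (\<Sum>j\<in>{1..d}. y j)"
      unfolding size_multiset_overloaded_eq cM using setM
      by (intro sum.mono_neutral_left) (auto simp: not_in_iff cM)
    then show ?thesis using y by (simp add: multinomial_support_def)
  qed
  have iff: "J \<in> fiber N d y \<longleftrightarrow> J \<in> words N {1..d} \<and> image_mset J (mset_set {..<N}) = M" for J
    by (simp add: fiber_def multiset_eq_iff count_image_mset_word cM fun_eq_iff)
  \<comment> \<open>The inverse map is restricted to \<open>{..<N}\<close> because words are
    \<open>undefined\<close> at all other arguments.\<close>
  have bij: "bij_betw (\<lambda>J. map J [0..<N]) (fiber N d y) (permutations_of_multiset M)"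
  proof (rule bij_betw_byWitness[where f' = "\<lambda>xs. \<lambda>i\<in>{..<N}. xs ! i"])
    show "\<forall>J\<in>fiber N d y. (\<lambda>i\<in>{..<N}. map J [0..<N] ! i) = J"
      by (auto simp: fiber_def words_def PiE_iff extensional_def fun_eq_iff)
    have len: "length xs = N" if "xs \<in> permutations_of_multiset M" for xs
      using that sizeM by (auto simp: permutations_of_multiset_def)
    show "\<forall>xs\<in>permutations_of_multiset M. map (\<lambda>i\<in>{..<N}. xs ! i) [0..<N] = xs"
      using len by (auto intro!: nth_equalityI)
    show "(\<lambda>J. map J [0..<N]) ` fiber N d y \<subseteq> permutations_of_multiset M"
      by (auto simp: iff permutations_of_multiset_def atLeast0LessThan)
    show "(\<lambda>xs. \<lambda>i\<in>{..<N}. xs ! i) ` permutations_of_multiset M \<subseteq> fiber N d y"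
    proof safe
      fix xs assume xs: "xs \<in> permutations_of_multiset M"
      have mset: "mset xs = M" using xs by (simp add: permutations_of_multiset_def)
      have "xs ! i \<in> {1..d}" if "i < N" for i
        using that setM mset len[OF xs] by (metis nth_mem set_mset_mset subsetD)
      then have "(\<lambda>i\<in>{..<N}. xs ! i) \<in> words N {1..d}" by (auto simp: words_def)
      moreover have "image_mset (\<lambda>i\<in>{..<N}. xs ! i) (mset_set {..<N}) = image_mset (\<lambda>i. xs ! i) (mset_set {..<N})"
        by (intro image_mset_cong) auto
      moreover have "\<dots> = mset (map (\<lambda>i. xs ! i) [0..<N])"
        by (simp add: atLeast0LessThan)
      moreover have "map (\<lambda>i. xs ! i) [0..<N] = xs"
        using len[OF xs] by (metis map_nth)
      ultimately show "(\<lambda>i\<in>{..<N}. xs ! i) \<in> fiber N d y"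
        using mset by (simp add: iff)
    qed
  qed
  have "card (fiber N d y) = fact N div (\<Prod>j\<in>set_mset M. fact (y j))"
    using bij_betw_same_card[OF bij] card_permutations_of_multiset(1)[of M] by (simp add: sizeM cM)
  \<comment> \<open>Divisibility makes the natural-number quotient exact, so it agrees with the real
    quotient.\<close>
  moreover have "(\<Prod>j\<in>set_mset M. fact (y j)) dvd (fact N :: nat)"
    using card_permutations_of_multiset(2)[of M] by (simp add: sizeM cM)
  moreover have "(\<Prod>j\<in>set_mset M. fact (y j)) = (\<Prod>j=1..d. fact (y j) :: nat)"
    using setM by (intro prod.mono_neutral_left) (auto simp: not_in_iff cM)
  ultimately show "real (card (fiber N d y)) = fact N / (\<Prod>j=1..d. fact (y j))"
    by (simp add: real_of_nat_div)
  show "fiber N d y \<noteq> {}"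
    using bij by (metis bij_betw_empty1 permutations_of_multiset_not_empty)
qed

text \<open>For a probability vector \<open>P\<close>, the multinomial is the law of the letter
  counts of \<open>N\<close> independent letters: words of one fiber have equal weight, and
  \<open>card_fiber\<close> counts them.\<close>

lemma sum_multinomial_mass:
  "(\<Sum>y\<in>multinomial_support N d. multinomial_mass N d P y * g y)
     = (\<Sum>J\<in>words N {1..d}. (\<Prod>i<N. P (J i)) * g (letter_count N J))"
proof -
  have "multinomial_mass N d P y * g y
      = (\<Sum>J\<in>{J\<in>words N {1..d}. letter_count N J = y}. (\<Prod>i<N. P (J i)) * g (letter_count N J))"
    if y: "y \<in> multinomial_support N d" for y
  proof -
    have "(\<Prod>i<N. P (J i)) = (\<Prod>j=1..d. P j ^ y j)" if "J \<in> fiber N d y" for J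
      using prod_power_letter_count[of J N "{1..d}" P] that by (auto simp: fiber_def)
    then have *: "(\<Sum>J\<in>fiber N d y. (\<Prod>i<N. P (J i)) * g (letter_count N J))
        = (\<Sum>J\<in>fiber N d y. (\<Prod>j=1..d. P j ^ y j) * g y)"
      by (intro sum.cong) (auto simp: fiber_def)
    show ?thesis
      unfolding fiber_def[symmetric] * by (simp add: card_fiber(1)[OF y] multinomial_mass_def)
  qed
  then have "(\<Sum>y\<in>multinomial_support N d. multinomial_mass N d P y * g y)
    = (\<Sum>y\<in>multinomial_support N d. \<Sum>J\<in>{J\<in>words N {1..d}. letter_count N J = y}.
        (\<Prod>i<N. P (J i)) * g (letter_count N J))"
    by (rule sum.cong[OF refl])
  also have "\<dots> = (\<Sum>J\<in>words N {1..d}. (\<Prod>i<N. P (J i)) * g (letter_count N J))"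
    by (intro sum.group finite_multinomial_support finite_words)
      (auto intro: letter_count_in_support[simplified])
  finally show ?thesis .
qed

subsection \<open>Product functions on words\<close>

text \<open>The sum over words factorizes into one inner product of \<open>u (k i)\<close> and
  \<open>u (l i)\<close> per position, which is zero wherever \<open>k\<close> and \<open>l\<close>
  differ.\<close>

lemma word_functions_orthonormal:
  assumes "orthonormal_functions d P u" and k: "k \<in> words N {..<d}" and l: "l \<in> words N {..<d}"
  shows "(\<Sum>J\<in>words N {1..d}. (\<Prod>i<N. P (J i)) * ((\<Prod>i<N. u (k i) (J i)) * (\<Prod>i<N. u (l i) (J i))))
       = (if k = l then 1 else 0)"
proof -
  have "(\<Sum>J\<in>words N {1..d}. (\<Prod>i<N. P (J i)) * ((\<Prod>i<N. u (k i) (J i)) * (\<Prod>i<N. u (l i) (J i))))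
      = (\<Prod>i<N. \<Sum>j=1..d. u (k i) j * u (l i) j * P j)"
    by (simp add: prod_sum_PiE words_def prod.distrib mult_ac)
  also have "\<dots> = (\<Prod>i<N. if k i = l i then 1 else 0)"
    using assms wordsD[OF k] wordsD[OF l] by (intro prod.cong) (auto simp: orthonormal_functions_def)
  also have "\<dots> = (if k = l then 1 else 0)"
  proof (cases "k = l")
    case False
    then obtain i where "i < N" "k i \<noteq> l i"
      using k l unfolding words_def by (metis PiE_ext lessThan_iff)
    then show ?thesis using False by (auto intro!: prod_zero)
  qed simp
  finally show ?thesis .
qed

text \<open>The polynomial is a sum of orthonormal product functions indexed by distinct words, so
  its squared norm is the number of summands.\<close>

lemma multi_krawtchouk_norm:
  assumes orth: "orthonormal_functions d P u" and d: "d \<ge> 1"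
  shows "(\<Sum>y\<in>multinomial_support N d. multinomial_mass N d P y * (multi_krawtchouk d u m y)\<^sup>2)
       = real (card {k\<in>words N {..<d}. word_exponent N k = m})"
proof -
  let ?T = "{k\<in>words N {..<d}. word_exponent N k = m}"
  have u0: "\<forall>j\<in>{1..d}. u 0 j = 1" using orth by (simp add: orthonormal_functions_def)
  have "(\<Sum>y\<in>multinomial_support N d. multinomial_mass N d P y * (multi_krawtchouk d u m y)\<^sup>2)
      = (\<Sum>J\<in>words N {1..d}. \<Sum>k\<in>?T. \<Sum>l\<in>?T.
          (\<Prod>i<N. P (J i)) * ((\<Prod>i<N. u (k i) (J i)) * (\<Prod>i<N. u (l i) (J i))))"
    unfolding sum_multinomial_mass
    by (intro sum.cong refl, simp only: multi_krawtchouk_letter_count[where u = u, OF u0 d]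
        power2_eq_square sum_product) (simp only: sum_distrib_left)
  also have "\<dots> = (\<Sum>k\<in>?T. \<Sum>l\<in>?T. \<Sum>J\<in>words N {1..d}.
          (\<Prod>i<N. P (J i)) * ((\<Prod>i<N. u (k i) (J i)) * (\<Prod>i<N. u (l i) (J i))))"
    by (subst sum.swap) (intro sum.cong refl sum.swap)
  also have "\<dots> = (\<Sum>k\<in>?T. \<Sum>l\<in>?T. if k = l then 1 else 0)"
    by (intro sum.cong refl word_functions_orthonormal[OF orth]) auto
  also have "\<dots> = real (card ?T)" by simp
  finally show ?thesis .
qed

text \<open>Each position with a nonzero letter adds one to the degree. This turns a sum over
  exponents of degree \<open>n\<close> into a sum over words with \<open>n\<close> nonconstant
  factors.\<close>

lemma word_exponent_in_multi_degrees_iff: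
  assumes k: "k \<in> words N {..<d}"
  shows "word_exponent N k \<in> multi_degrees d n \<longleftrightarrow> card {i\<in>{..<N}. k i \<noteq> 0} = n"
proof -
  have "Poly_Mapping.keys (word_exponent N k) \<subseteq> {1..<d}"
  proof
    fix l assume "l \<in> Poly_Mapping.keys (word_exponent N k)"
    then have "l \<noteq> 0" "{i\<in>{..<N}. k i = l} \<noteq> {}"
      unfolding in_keys_iff lookup_word_exponent letter_count_def
      by (auto split: if_splits simp del: Collect_empty_eq)
    then show "l \<in> {1..<d}" using wordsD[OF k] by auto
  qed
  moreover have "(\<Sum>l\<in>{1..<d}. Poly_Mapping.lookup (word_exponent N k) l) = card {i\<in>{..<N}. k i \<noteq> 0}"
  proof -
    have "(\<Sum>l\<in>{1..<d}. \<Sum>i\<in>{i\<in>{i\<in>{..<N}. k i \<noteq> 0}. k i = l}. 1::nat) = (\<Sum>i\<in>{i\<in>{..<N}. k i \<noteq> 0}. 1)"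
      using wordsD[OF k] by (intro sum.group) auto
    moreover have "{i\<in>{i\<in>{..<N}. k i \<noteq> 0}. k i = l} = {i\<in>{..<N}. k i = l}" if "l \<in> {1..<d}" for l
      using that by auto
    ultimately show ?thesis by (simp add: lookup_word_exponent letter_count_def)
  qed
  ultimately show ?thesis by (simp add: multi_degrees_def)
qed

text \<open>Averaging a product function over a fiber depends only on its exponent, so the product of
  the two symmetric sums in the kernel collapses to a single sum over words.\<close>

lemma reproducing_kernel_word_sum:
  assumes orth: "orthonormal_functions d P u" and d: "d \<ge> 1"
    and J: "J \<in> words N {1..d}" and y: "y \<in> multinomial_support N d"
  shows "reproducing_kernel N d P u n (letter_count N J) y
       = (\<Sum>J'\<in>fiber N d y. \<Sum>k\<in>{k\<in>words N {..<d}. card {i\<in>{..<N}. k i \<noteq> 0} = n}.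
            \<Prod>i<N. u (k i) (J i) * u (k i) (J' i)) / real (card (fiber N d y))"
proof -
  define T where "T m = {k\<in>words N {..<d}. word_exponent N k = m}" for m
  define g where "g k = (\<Sum>J'\<in>fiber N d y. \<Prod>i<N. u (k i) (J' i))" for k
  let ?c = "real (card (fiber N d y))"
  have u0: "\<forall>j\<in>{1..d}. u 0 j = 1" using orth by (simp add: orthonormal_functions_def)
  have c: "?c \<noteq> 0" using card_fiber(2)[OF y] by (simp add: card_eq_0_iff)
  have finT: "finite (T m)" for m by (simp add: T_def)
  have g: "g k = g l" if "k \<in> T m" "l \<in> T m" for k l m
    unfolding g_def using that d
    by (intro sum_fiber_symmetric word_exponent_eq_imp_letter_count_eq) (auto simp: T_def)
  \<comment> \<open>The value at \<open>y\<close> has an expansion for every word of the fiber;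
    summing these over the fiber multiplies the value by \<open>?c\<close>.\<close>
  have Qy: "?c * multi_krawtchouk d u m y = (\<Sum>l\<in>T m. g l)" for m
  proof -
    have "multi_krawtchouk d u m y = (\<Sum>k\<in>T m. \<Prod>i<N. u (k i) (J' i))" if "J' \<in> fiber N d y" for J'
      using multi_krawtchouk_letter_count[of d u J' N m] u0 d that by (simp add: fiber_def T_def)
    then have "(\<Sum>J'\<in>fiber N d y. multi_krawtchouk d u m y)
        = (\<Sum>J'\<in>fiber N d y. \<Sum>k\<in>T m. \<Prod>i<N. u (k i) (J' i))"
      by (intro sum.cong) auto
    also have "\<dots> = (\<Sum>k\<in>T m. g k)" unfolding g_def by (rule sum.swap)
    finally show ?thesis by simp
  qed
  have summand: "multi_krawtchouk_normalized N d P u m (letter_count N J) * multi_krawtchouk_normalized N d P u m y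
      = (\<Sum>k\<in>T m. (\<Prod>i<N. u (k i) (J i)) * g k) / ?c" for m
  \<comment> \<open>If no word has exponent \<open>m\<close>, as when its degree exceeds
    \<open>N\<close>, the norm is zero, and division by zero makes the normalized polynomial zero,
    matching the empty sum.\<close>
  proof (cases "T m = {}")
    case True
    then show ?thesis
      using multi_krawtchouk_norm[OF orth d, of N m]
      by (simp add: multi_krawtchouk_normalized_def flip: T_def)
  next
    case False
    then obtain k0 where k0: "k0 \<in> T m" by blast
    have cT: "real (card (T m)) > 0" using False finT by (simp add: card_gt_0_iff)
    \<comment> \<open>By symmetry \<open>g\<close> is constant on \<open>T m\<close>; the resulting
      factor \<open>card (T m)\<close> cancels against the squared norm.\<close>
    have "(\<Sum>l\<in>T m. g l) = (\<Sum>l\<in>T m. g k0)" by (intro sum.cong refl g[OF _ k0])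
    then have Qy': "multi_krawtchouk d u m y = real (card (T m)) * g k0 / ?c"
      using Qy[of m] c by (simp add: field_simps)
    have "(\<Sum>k\<in>T m. (\<Prod>i<N. u (k i) (J i)) * g k) = (\<Sum>k\<in>T m. (\<Prod>i<N. u (k i) (J i)) * g k0)"
      by (intro sum.cong refl arg_cong2[where f = "(*)"] g[OF _ k0])
    also have "\<dots> = multi_krawtchouk d u m (letter_count N J) * g k0"
      by (simp add: multi_krawtchouk_letter_count[where u = u, OF u0 d J] T_def sum_distrib_right)
    finally have "(\<Sum>k\<in>T m. (\<Prod>i<N. u (k i) (J i)) * g k)
      = multi_krawtchouk d u m (letter_count N J) * g k0" .
    moreover have "multi_krawtchouk_normalized N d P u m (letter_count N J) * multi_krawtchouk_normalized N d P u m y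
        = multi_krawtchouk d u m (letter_count N J) * multi_krawtchouk d u m y / real (card (T m))"
      using cT multi_krawtchouk_norm[OF orth d, of N m]
      by (simp add: multi_krawtchouk_normalized_def flip: T_def)
    ultimately show ?thesis using cT by (simp add: Qy')
  qed
  let ?K = "{k\<in>words N {..<d}. card {i\<in>{..<N}. k i \<noteq> 0} = n}"
  have "reproducing_kernel N d P u n (letter_count N J) y
      = (\<Sum>m\<in>multi_degrees d n. \<Sum>k\<in>T m. (\<Prod>i<N. u (k i) (J i)) * g k) / ?c"
    by (simp add: reproducing_kernel_def summand sum_divide_distrib)
  \<comment> \<open>A word with \<open>n\<close> nonzero letters has exactly one exponent, which is
    of degree \<open>n\<close>, so the double sum groups a single sum over words.\<close>
  also have "(\<Sum>m\<in>multi_degrees d n. \<Sum>k\<in>T m. (\<Prod>i<N. u (k i) (J i)) * g k)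
      = (\<Sum>m\<in>multi_degrees d n. \<Sum>k\<in>{k\<in>?K. word_exponent N k = m}. (\<Prod>i<N. u (k i) (J i)) * g k)"
    by (intro sum.cong) (auto simp: T_def word_exponent_in_multi_degrees_iff)
  also have "\<dots> = (\<Sum>k\<in>?K. (\<Prod>i<N. u (k i) (J i)) * g k)"
    by (intro sum.group finite_multi_degrees) (auto simp: word_exponent_in_multi_degrees_iff)
  also have "\<dots> = (\<Sum>J'\<in>fiber N d y. \<Sum>k\<in>?K. \<Prod>i<N. u (k i) (J i) * u (k i) (J' i))"
    by (subst sum.swap) (simp add: g_def sum_distrib_left prod.distrib)
  finally show ?thesis .
qed

subsection \<open>One-dimensional Krawtchouk polynomials as subset averages\<close>

text \<open>Classifies the sets \<open>A\<close> by \<open>card (A \<inter> S)\<close>: the parts of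
  \<open>A\<close> inside and outside \<open>S\<close> are chosen independently.\<close>

lemma sum_power_card_inter:
  fixes r :: real
  assumes S: "S \<subseteq> {..<N}"
  shows "(\<Sum>A\<in>{A. A \<subseteq> {..<N} \<and> card A = n}. r ^ card (A \<inter> S))
       = (\<Sum>\<nu>\<le>n. r ^ \<nu> * real (card S choose \<nu>) * real ((N - card S) choose (n - \<nu>)))"
proof -
  let ?X = "{A. A \<subseteq> {..<N} \<and> card A = n}"
  have finX: "finite ?X" by (rule finite_subset[of _ "Pow {..<N}"]) auto
  have finS: "finite S" using S finite_subset by blast
  have card: "card {A\<in>?X. card (A \<inter> S) = \<nu>} = (card S choose \<nu>) * ((N - card S) choose (n - \<nu>))"
    if "\<nu> \<le> n" for \<nu>
  proof -
    have "bij_betw (\<lambda>A. (A \<inter> S, A - S)) {A\<in>?X. card (A \<inter> S) = \<nu>}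
        ({B. B \<subseteq> S \<and> card B = \<nu>} \<times> {C. C \<subseteq> {..<N} - S \<and> card C = n - \<nu>})"
    proof (rule bij_betw_byWitness[where f' = "\<lambda>(B, C). B \<union> C"])
      show "(\<lambda>A. (A \<inter> S, A - S)) ` {A\<in>?X. card (A \<inter> S) = \<nu>}
          \<subseteq> {B. B \<subseteq> S \<and> card B = \<nu>} \<times> {C. C \<subseteq> {..<N} - S \<and> card C = n - \<nu>}"
        using finS by (auto simp: card_Diff_subset_Int)
      show "(\<lambda>(B, C). B \<union> C) ` ({B. B \<subseteq> S \<and> card B = \<nu>} \<times> {C. C \<subseteq> {..<N} - S \<and> card C = n - \<nu>})
          \<subseteq> {A\<in>?X. card (A \<inter> S) = \<nu>}"
      proof clarsimp
        fix B C assume BC: "B \<subseteq> S" "C \<subseteq> {..<N} - S" "card C = n - card B" "\<nu> = card B"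
        have "finite B" "finite C" "B \<inter> C = {}" "(B \<union> C) \<inter> S = B"
          using BC finS finite_subset[of C "{..<N}"] by (auto intro: finite_subset)
        then show "B \<subseteq> {..<N} \<and> C \<subseteq> {..<N} \<and> card (B \<union> C) = n \<and> card ((B \<union> C) \<inter> S) = card B"
          using BC S that by (auto simp: card_Un_disjoint)
      qed
    qed auto
    then have "card {A\<in>?X. card (A \<inter> S) = \<nu>}
        = card ({B. B \<subseteq> S \<and> card B = \<nu>} \<times> {C. C \<subseteq> {..<N} - S \<and> card C = n - \<nu>})"
      by (rule bij_betw_same_card)
    also have "\<dots> = (card S choose \<nu>) * ((N - card S) choose (n - \<nu>))"
      using finS S by (simp add: card_cartesian_product n_subsets card_Diff_subset)
    finally show ?thesis .
  qed
  have "(\<Sum>A\<in>?X. r ^ card (A \<inter> S)) = (\<Sum>\<nu>\<le>n. \<Sum>A\<in>{A\<in>?X. card (A \<inter> S) = \<nu>}. r ^ card (A \<inter> S))"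
    by (intro sum.group[symmetric] finX) (auto intro!: card_mono finite_subset[of _ "{..<N}"])
  also have "\<dots> = (\<Sum>\<nu>\<le>n. r ^ \<nu> * real (card S choose \<nu>) * real ((N - card S) choose (n - \<nu>)))"
  proof (intro sum.cong refl)
    fix \<nu> assume "\<nu> \<in> {..n}"
    then have "real (card {A\<in>?X. card (A \<inter> S) = \<nu>})
        = real (card S choose \<nu>) * real ((N - card S) choose (n - \<nu>))"
      by (subst card) auto
    moreover have "(\<Sum>A\<in>{A\<in>?X. card (A \<inter> S) = \<nu>}. r ^ card (A \<inter> S))
        = real (card {A\<in>?X. card (A \<inter> S) = \<nu>}) * r ^ \<nu>"
      by (subst sum.cong[of _ _ _ "\<lambda>_. r ^ \<nu>"]) auto
    ultimately show "(\<Sum>A\<in>{A\<in>?X. card (A \<inter> S) = \<nu>}. r ^ card (A \<inter> S))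
        = r ^ \<nu> * real (card S choose \<nu>) * real ((N - card S) choose (n - \<nu>))"
      by (simp add: mult_ac)
  qed
  finally show ?thesis .
qed

lemma krawtchouk_subset_sum:
  assumes S: "S \<subseteq> {..<N}"
  shows "krawtchouk N p n (card S)
       = (\<Sum>A\<in>{A. A \<subseteq> {..<N} \<and> card A = n}. (- ((1 - p) / p)) ^ card (A \<inter> S)) / real (N choose n)"
  unfolding krawtchouk_def sum_power_card_inter[OF S] ..

text \<open>Duality in the two arguments, by double counting pairs of subsets.\<close>

lemma krawtchouk_subset_sum_dual:
  assumes A: "A \<subseteq> {..<N}" and z: "z \<le> N"
  shows "krawtchouk N p (card A) z
       = (\<Sum>S\<in>{S. S \<subseteq> {..<N} \<and> card S = z}. (- ((1 - p) / p)) ^ card (A \<inter> S)) / real (N choose z)"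
proof -
  let ?X = "\<lambda>n. {A. A \<subseteq> {..<N} \<and> card A = n}" and ?r = "- ((1 - p) / p)"
  have n: "card A \<le> N" using A by (metis card_lessThan card_mono finite_lessThan)
  have cX: "card (?X n) = N choose n" for n by (simp add: n_subsets)
  let ?n = "card A"
  have "(\<Sum>S\<in>?X z. \<Sum>B\<in>?X ?n. ?r ^ card (B \<inter> S)) = (\<Sum>S\<in>?X z. real (N choose ?n) * krawtchouk N p ?n z)"
    using n by (intro sum.cong) (auto simp: krawtchouk_subset_sum)
  \<comment> \<open>The inner sum depends on \<open>B\<close> only through its size, by
    \<open>sum_power_card_inter\<close> with the two sets exchanged, so \<open>A\<close> may replace
    every \<open>B\<close>.\<close>
  moreover have "(\<Sum>B\<in>?X ?n. \<Sum>S\<in>?X z. ?r ^ card (B \<inter> S))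
      = (\<Sum>B\<in>?X ?n. \<Sum>S\<in>?X z. ?r ^ card (A \<inter> S))"
  proof (rule sum.cong[OF refl])
    fix B assume "B \<in> ?X ?n"
    then show "(\<Sum>S\<in>?X z. ?r ^ card (B \<inter> S)) = (\<Sum>S\<in>?X z. ?r ^ card (A \<inter> S))"
      using sum_power_card_inter[of B N ?r z] sum_power_card_inter[OF A, of ?r z]
      by (simp add: Int_commute)
  qed
  ultimately have "real (N choose z) * (real (N choose ?n) * krawtchouk N p ?n z)
      = real (N choose ?n) * (\<Sum>S\<in>?X z. ?r ^ card (A \<inter> S))"
    using sum.swap[of "\<lambda>S B. ?r ^ card (B \<inter> S)" "?X ?n" "?X z"] by (auto simp: cX)
  then show ?thesis using n z by (simp add: field_simps)
qed

subsection \<open>The triple kernel\<close>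

text \<open>Orthonormality says that a product of two square matrices is the identity. A one-sided
  inverse is two-sided, and the reversed product is the relation summed over the functions
  \<open>l\<close>.\<close>

lemma dual_orthogonality:
  assumes orth: "orthonormal_functions d P u" and a: "a \<in> {1..d}" and b: "b \<in> {1..d}"
    and P: "P a > 0"
  shows "(\<Sum>l<d. u l a * u l b) = (if a = b then 1 / P a else 0)"
proof -
  define A where "A = mat d d (\<lambda>(k, j). u k (Suc j))"
  define B where "B = mat d d (\<lambda>(j, k). u k (Suc j) * P (Suc j))"
  \<comment> \<open>Matrix indices start at \<open>0\<close>, coordinates at
    \<open>1\<close>.\<close>
  have shift: "(\<Sum>j<d. f (Suc j)) = (\<Sum>j=1..d. f j)" for f :: "nat \<Rightarrow> real"
    by (rule sum.reindex_bij_witness[where i = "\<lambda>j. j - 1" and j = Suc]) auto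
  have "A * B = 1\<^sub>m d"
    using orth unfolding orthonormal_functions_def
    by (intro eq_matI)
      (auto simp: A_def B_def scalar_prod_def atLeast0LessThan mult.assoc
        shift[where f = "\<lambda>j. u _ j * (u _ j * P j)"])
  then have "B * A = 1\<^sub>m d"
    by (rule mat_mult_left_right_inverse[rotated 2]) (auto simp: A_def B_def)
  moreover have ab: "a - 1 < d" "b - 1 < d" "Suc (a - 1) = a" "Suc (b - 1) = b" using a b by auto
  ultimately have "(B * A) $$ (a - 1, b - 1) = (if a = b then 1 else 0)"
    using a b by auto
  then have "(\<Sum>l<d. u l a * P a * u l b) = (if a = b then 1 else 0)"
    using ab by (simp add: A_def B_def scalar_prod_def atLeast0LessThan)
  moreover have "(\<Sum>l<d. u l a * P a * u l b) = P a * (\<Sum>l<d. u l a * u l b)"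
    by (simp add: sum_distrib_left mult_ac)
  ultimately show ?thesis using P by (auto simp: field_simps split: if_splits)
qed

text \<open>The numbers \<xi>: the reproducing kernel of all functions on a single letter, which is
  the sum of \<open>u l a * u l b\<close> over \<open>l < d\<close> by
  \<open>dual_orthogonality\<close>.\<close>

definition match_ratio :: "(nat \<Rightarrow> real) \<Rightarrow> nat \<Rightarrow> nat \<Rightarrow> real" where
  "match_ratio P a b = (if a = b then 1 / P a else 0)"

text \<open>Summing over the degree \<open>n\<close> lifts the restriction on the number of nonzero
  letters, and the sum over all words then factorizes over the positions.\<close>

lemma triple_kernel_average:
  assumes orth: "orthonormal_functions d P u" and d: "d \<ge> 1"
    and P: "\<forall>j\<in>{1..d}. P j > 0" and p: "0 < p" "p < 1"
    and J: "J \<in> words N {1..d}" and y: "y \<in> multinomial_support N d" and z: "z \<le> N"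
  shows "triple_kernel N d p P u (letter_count N J) y z
       = (\<Sum>J'\<in>fiber N d y. \<Sum>S\<in>{S. S \<subseteq> {..<N} \<and> card S = z}.
            \<Prod>i<N. if i \<in> S then (1 - (1 - p) * match_ratio P (J i) (J' i)) / p
                  else match_ratio P (J i) (J' i))
          / (real (card (fiber N d y)) * real (N choose z))"
proof -
  let ?r = "- ((1 - p) / p)" and ?c = "real (card (fiber N d y))"
  let ?X = "{S. S \<subseteq> {..<N} \<and> card S = z}"
  let ?supp = "\<lambda>k. {i\<in>{..<N}. k i \<noteq> (0::nat)}"
  let ?W = "\<lambda>J' k. \<Prod>i<N. u (k i) (J i) * u (k i) (J' i)"
  have u0: "\<forall>j\<in>{1..d}. u 0 j = 1" using orth by (simp add: orthonormal_functions_def)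
  \<comment> \<open>At a position of \<open>S\<close> the nonconstant functions carry the weight
    \<open>?r\<close>, which gives \<open>1 + ?r * (\<xi> - 1) = (1 - (1 - p) * \<xi>) / p\<close>;
    elsewhere the sum is \<xi> itself.\<close>
  have factor: "(\<Sum>l<d. (if i \<in> S \<and> l \<noteq> 0 then ?r else 1) * (u l a * u l b))
      = (if i \<in> S then (1 - (1 - p) * match_ratio P a b) / p else match_ratio P a b)"
    if ab: "a \<in> {1..d}" "b \<in> {1..d}" for i :: nat and S a b
  proof -
    have dual: "(\<Sum>l<d. u l a * u l b) = match_ratio P a b"
      unfolding match_ratio_def by (rule dual_orthogonality[OF orth ab bspec[OF P ab(1)]])
    have ins: "{..<d} = insert 0 {1..<d}" using d by auto
    have rest: "(\<Sum>l\<in>{1..<d}. u l a * u l b) = match_ratio P a b - 1"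
      using dual ab by (simp add: ins u0)
    have "(\<Sum>l<d. (if l \<noteq> 0 then ?r else 1) * (u l a * u l b))
        = 1 + (\<Sum>l\<in>{1..<d}. ?r * (u l a * u l b))"
      using ab by (simp add: ins u0)
    also have "\<dots> = 1 + ?r * (match_ratio P a b - 1)"
      by (simp only: sum_distrib_left[symmetric] rest)
    also have "\<dots> = (1 - (1 - p) * match_ratio P a b) / p"
      using p by (simp add: field_simps)
    finally show ?thesis using dual by (cases "i \<in> S") simp_all
  qed
  have "triple_kernel N d p P u (letter_count N J) y z
      = (\<Sum>n=0..N. \<Sum>J'\<in>fiber N d y. \<Sum>k\<in>{k\<in>words N {..<d}. card (?supp k) = n}.
          krawtchouk N p (card (?supp k)) z * ?W J' k) / ?c"
    unfolding triple_kernel_def reproducing_kernel_word_sum[OF orth d J y] sum_divide_distrib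
    by (intro sum.cong refl) (simp add: sum_distrib_left)
  also have "(\<Sum>n=0..N. \<Sum>J'\<in>fiber N d y. \<Sum>k\<in>{k\<in>words N {..<d}. card (?supp k) = n}.
          krawtchouk N p (card (?supp k)) z * ?W J' k)
      = (\<Sum>J'\<in>fiber N d y. \<Sum>n=0..N. \<Sum>k\<in>{k\<in>words N {..<d}. card (?supp k) = n}.
          krawtchouk N p (card (?supp k)) z * ?W J' k)"
    by (rule sum.swap)
  also have "\<dots> = (\<Sum>J'\<in>fiber N d y. \<Sum>k\<in>words N {..<d}. krawtchouk N p (card (?supp k)) z * ?W J' k)"
  proof (intro sum.cong refl sum.group)
    have "card (?supp k) \<le> N" for k :: "nat \<Rightarrow> nat"
      using card_mono[of "{..<N}" "?supp k"] by auto
    then show "(\<lambda>k. card (?supp k)) ` words N {..<d} \<subseteq> {0..N}" by auto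
  qed auto
  also have "\<dots> = (\<Sum>J'\<in>fiber N d y. \<Sum>S\<in>?X.
            \<Prod>i<N. if i \<in> S then (1 - (1 - p) * match_ratio P (J i) (J' i)) / p
                  else match_ratio P (J i) (J' i)) / real (N choose z)"
    unfolding sum_divide_distrib[of _ "fiber N d y"]
  proof (intro sum.cong refl)
    fix J' assume J': "J' \<in> fiber N d y"
    \<comment> \<open>Spreads the power over the positions, so that it merges with the product of
      the functions \<open>u\<close>.\<close>
    have pw: "?r ^ card (?supp k \<inter> S) = (\<Prod>i<N. if i \<in> S \<and> k i \<noteq> 0 then ?r else 1)" for k S
    proof -
      have "(\<Prod>i<N. if i \<in> S \<and> k i \<noteq> 0 then ?r else 1) = (\<Prod>i\<in>?supp k \<inter> S. ?r)"
        by (rule prod.mono_neutral_cong_right) auto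
      then show ?thesis by simp
    qed
    have "(\<Sum>k\<in>words N {..<d}. krawtchouk N p (card (?supp k)) z * ?W J' k)
        = (\<Sum>k\<in>words N {..<d}. \<Sum>S\<in>?X. (\<Prod>i<N. (if i \<in> S \<and> k i \<noteq> 0 then ?r else 1) *
              (u (k i) (J i) * u (k i) (J' i)))) / real (N choose z)"
      unfolding sum_divide_distrib[of _ "words _ _"]
    proof (intro sum.cong refl)
      fix k
      have "?supp k \<subseteq> {..<N}" by auto
      \<comment> \<open>In the dual form \<open>S\<close> ranges over the sets of size
        \<open>z\<close>, independently of the word \<open>k\<close>, so the two sums can be
        exchanged.\<close>
      from krawtchouk_subset_sum_dual[OF this z, of p]
      show "krawtchouk N p (card (?supp k)) z * ?W J' k = (\<Sum>S\<in>?X. (\<Prod>i<N.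
          (if i \<in> S \<and> k i \<noteq> 0 then ?r else 1) * (u (k i) (J i) * u (k i) (J' i)))) / real (N choose z)"
        by (simp only: pw sum_distrib_right prod.distrib times_divide_eq_left)
    qed
    also have "\<dots> = (\<Sum>S\<in>?X. \<Sum>k\<in>words N {..<d}. (\<Prod>i<N. (if i \<in> S \<and> k i \<noteq> 0 then ?r else 1) *
              (u (k i) (J i) * u (k i) (J' i)))) / real (N choose z)"
      by (subst sum.swap) simp
    also have "\<dots> = (\<Sum>S\<in>?X. \<Prod>i<N. \<Sum>l<d. (if i \<in> S \<and> l \<noteq> 0 then ?r else 1) *
              (u l (J i) * u l (J' i))) / real (N choose z)"
      by (simp add: prod_sum_PiE words_def)
    also have "\<dots> = (\<Sum>S\<in>?X. \<Prod>i<N. if i \<in> S then (1 - (1 - p) * match_ratio P (J i) (J' i)) / p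
                  else match_ratio P (J i) (J' i)) / real (N choose z)"
      using J' by (intro arg_cong2[where f = "(/)"] sum.cong prod.cong refl factor)
        (auto simp: fiber_def dest: wordsD[OF J] wordsD)
    finally show "(\<Sum>k\<in>words N {..<d}. krawtchouk N p (card (?supp k)) z * ?W J' k) = \<dots>" .
  qed
  finally show ?thesis by (simp add: mult.commute)
qed

text \<open>Let \<open>S\<close> contain each position independently with probability
  \<open>p\<close>. Both polynomials at \<open>card S\<close> are averages of powers of
  \<open>?r\<close> over sets \<open>A\<close> and \<open>B\<close>, and the expectation of each
  product of powers factorizes over the positions.\<close>

lemma krawtchouk_orthogonal:
  assumes p: "0 < p" "p < 1" and n: "n \<le> N" and m: "m \<le> N"
  shows "(\<Sum>z=0..N. real (N choose z) * p ^ z * (1 - p) ^ (N - z) * (krawtchouk N p n z * krawtchouk N p m z))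
       = (if n = m then 1 / krawtchouk_h N p n else 0)"
proof -
  let ?r = "- ((1 - p) / p)" and ?q = "1 - p"
  let ?X = "\<lambda>n. {A. A \<subseteq> {..<N} \<and> card A = n}"
  have finX: "finite (?X n)" for n by (rule finite_subset[of _ "Pow {..<N}"]) auto
  have cX: "card (?X n) = N choose n" for n by (simp add: n_subsets)
  let ?f = "\<lambda>S. p ^ card S * ?q ^ (N - card S) * (krawtchouk N p n (card S) * krawtchouk N p m (card S))"
  have "(\<Sum>z=0..N. real (N choose z) * p ^ z * ?q ^ (N - z) * (krawtchouk N p n z * krawtchouk N p m z))
      = (\<Sum>z=0..N. \<Sum>S\<in>{S\<in>Pow {..<N}. card S = z}. ?f S)"
  proof (intro sum.cong refl)
    fix z
    \<comment> \<open>The binomial coefficient counts the sets of size \<open>z\<close>, so the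
      binomial weight splits into product weights of single sets.\<close>
    have "(\<Sum>S\<in>{S\<in>Pow {..<N}. card S = z}. ?f S)
        = real (N choose z) * p ^ z * ?q ^ (N - z) * (krawtchouk N p n z * krawtchouk N p m z)"
      by (simp add: cX)
    then show "real (N choose z) * p ^ z * ?q ^ (N - z) * (krawtchouk N p n z * krawtchouk N p m z)
        = (\<Sum>S\<in>{S\<in>Pow {..<N}. card S = z}. ?f S)" ..
  qed
  also have "\<dots> = (\<Sum>S\<in>Pow {..<N}. ?f S)"
  proof (intro sum.group)
    show "card ` Pow {..<N} \<subseteq> {0..N}" using card_mono[of "{..<N}"] by fastforce
  qed auto
  also have "\<dots> = (\<Sum>S\<in>Pow {..<N}. \<Sum>A\<in>?X n. \<Sum>B\<in>?X m.
      p ^ card S * ?q ^ (N - card S) * (?r ^ card (A \<inter> S) * ?r ^ card (B \<inter> S)))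
      / (real (N choose n) * real (N choose m))"
    unfolding sum_divide_distrib[of _ "Pow _"]
  proof (intro sum.cong refl)
    fix S assume "S \<in> Pow {..<N}"
    then have S: "S \<subseteq> {..<N}" by simp
    have "?f S = p ^ card S * ?q ^ (N - card S) *
        ((\<Sum>A\<in>?X n. ?r ^ card (A \<inter> S)) * (\<Sum>B\<in>?X m. ?r ^ card (B \<inter> S)))
        / (real (N choose n) * real (N choose m))"
      by (simp add: krawtchouk_subset_sum[OF S])
    also have "\<dots> = (\<Sum>A\<in>?X n. \<Sum>B\<in>?X m.
      p ^ card S * ?q ^ (N - card S) * (?r ^ card (A \<inter> S) * ?r ^ card (B \<inter> S)))
      / (real (N choose n) * real (N choose m))"
      unfolding sum_product by (simp only: sum_distrib_left)
    finally show "?f S = \<dots>" .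
  qed
  also have "(\<Sum>S\<in>Pow {..<N}. \<Sum>A\<in>?X n. \<Sum>B\<in>?X m.
      p ^ card S * ?q ^ (N - card S) * (?r ^ card (A \<inter> S) * ?r ^ card (B \<inter> S)))
    = (\<Sum>A\<in>?X n. \<Sum>B\<in>?X m. \<Sum>S\<in>Pow {..<N}.
      p ^ card S * ?q ^ (N - card S) * (?r ^ card (A \<inter> S) * ?r ^ card (B \<inter> S)))"
    by (subst sum.swap) (intro sum.cong refl sum.swap)
  also have "\<dots> = (\<Sum>A\<in>?X n. \<Sum>B\<in>?X m. if A = B then (?q / p) ^ n else 0)"
  proof (intro sum.cong refl)
    fix A B assume A: "A \<in> ?X n" and B: "B \<in> ?X m"
    have pw: "r ^ card (C \<inter> S) = (\<Prod>i\<in>S. if i \<in> C then r else 1)"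
      if "S \<subseteq> {..<N}" for r :: real and S C :: "nat set"
    proof -
      have "finite S" using that finite_subset by blast
      then have "(\<Prod>i\<in>S. if i \<in> C then r else 1) = (\<Prod>i\<in>S \<inter> C. r)"
        by (subst prod.inter_restrict) auto
      then show ?thesis by (simp add: Int_commute)
    qed
    have "(\<Sum>S\<in>Pow {..<N}. p ^ card S * ?q ^ (N - card S) * (?r ^ card (A \<inter> S) * ?r ^ card (B \<inter> S)))
        = (\<Sum>S\<in>Pow {..<N}. (\<Prod>i\<in>S. p * ((if i \<in> A then ?r else 1) * (if i \<in> B then ?r else 1)))
            * (\<Prod>i\<in>{..<N} - S. ?q))"
      by (intro sum.cong refl) (simp add: pw prod.distrib card_Diff_subset finite_subset[of _ "{..<N}"])
    also have "\<dots> = (\<Prod>i<N. p * ((if i \<in> A then ?r else 1) * (if i \<in> B then ?r else 1)) + ?q)"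
      by (rule prod_add[symmetric]) simp
    \<comment> \<open>A position in both sets gives \<open>p * ?r * ?r + ?q = ?q / p\<close>, a
      position in exactly one gives \<open>p * ?r + ?q = 0\<close>, and any other gives
      \<open>1\<close>. Hence only \<open>A = B\<close> survives.\<close>
    also have "\<dots> = (\<Prod>i<N. if i \<in> A \<and> i \<in> B then ?q / p else if i \<in> A \<or> i \<in> B then 0 else 1)"
      using p by (intro prod.cong refl) (auto simp: field_simps)
    also have "\<dots> = (if A = B then (?q / p) ^ n else 0)"
    proof (cases "A = B")
      case True
      then have "(\<Prod>i<N. if i \<in> A \<and> i \<in> B then ?q / p else if i \<in> A \<or> i \<in> B then 0 else 1)
          = (\<Prod>i\<in>{..<N}. if i \<in> A then ?q / p else 1)" by (intro prod.cong) auto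
      also have "\<dots> = (?q / p) ^ card (A \<inter> {..<N})" by (rule pw[symmetric]) simp
      also have "A \<inter> {..<N} = A" using A by auto
      finally show ?thesis using A True by simp
    next
      case False
      then obtain i where "i < N" "i \<in> A \<and> i \<notin> B \<or> i \<notin> A \<and> i \<in> B" using A B by blast
      then show ?thesis using False by (auto intro!: prod_zero bexI[of _ i])
    qed
    finally show "(\<Sum>S\<in>Pow {..<N}. p ^ card S * ?q ^ (N - card S) * (?r ^ card (A \<inter> S) * ?r ^ card (B \<inter> S)))
        = (if A = B then (?q / p) ^ n else 0)" .
  qed
  also have "\<dots> = (if n = m then real (N choose n) * (?q / p) ^ n else 0)"
  proof (cases "n = m")
    case True
    then show ?thesis using finX cX by (simp add: sum.delta')
  next
    case False
    then show ?thesis by (auto intro!: sum.neutral)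
  qed
  finally show ?thesis
    using n p by (simp add: krawtchouk_h_def power_divide)
qed

lemma krawtchouk_0: "krawtchouk N p 0 z = 1"
  by (simp add: krawtchouk_def)

text \<open>In degree zero only the word of zeros remains, whose product is \<open>1\<close>. This
  provides the total mass one in the duplication formula.\<close>

lemma reproducing_kernel_0:
  assumes orth: "orthonormal_functions d P u" and d: "d \<ge> 1"
    and J: "J \<in> words N {1..d}" and y: "y \<in> multinomial_support N d"
  shows "reproducing_kernel N d P u 0 (letter_count N J) y = 1"
proof -
  have u0: "\<forall>j\<in>{1..d}. u 0 j = 1" using orth by (simp add: orthonormal_functions_def)
  have "{k\<in>words N {..<d}. card {i\<in>{..<N}. k i \<noteq> 0} = 0} = {\<lambda>i\<in>{..<N}. 0}"
    using d by (auto simp: words_def PiE_iff extensional_def fun_eq_iff)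
  moreover have "(\<Prod>i<N. u 0 (J i) * u 0 (J' i)) = 1" if "J' \<in> fiber N d y" for J'
    using that u0 wordsD[OF J] by (intro prod.neutral) (auto simp: fiber_def dest: wordsD)
  ultimately show ?thesis
    unfolding reproducing_kernel_word_sum[OF orth d J y] using card_fiber(2)[OF y] by simp
qed

subsection \<open>Nonnegativity and duplication\<close>

theorem theorem4:
  fixes N d :: nat and p :: real and P :: "nat \<Rightarrow> real" and u :: "nat \<Rightarrow> nat \<Rightarrow> real"
  assumes "N \<ge> 1" and "d \<ge> 2"
    and "\<And>j. j \<in> {1..d} \<Longrightarrow> P j > 0" and "(\<Sum>j=1..d. P j) = 1"
    and "0 < p" and "p < 1"
    and "orthonormal_functions d P u"
  shows "((\<forall>x\<in>multinomial_support N d. \<forall>y\<in>multinomial_support N d. \<forall>z\<in>{0..N}.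
              triple_kernel N d p P u x y z \<ge> 0)
            \<longleftrightarrow> 1 - p \<le> Min (P ` {1..d}))
       \<and> (1 - p \<le> Min (P ` {1..d}) \<longrightarrow>
           (\<forall>x\<in>multinomial_support N d. \<forall>y\<in>multinomial_support N d.
              \<exists>\<phi> :: nat pmf.
                set_pmf \<phi> \<subseteq> {0..N} \<and>
                (\<forall>z\<in>{0..N}. pmf \<phi> z =
                   real (N choose z) * p ^ z * (1 - p) ^ (N - z) * triple_kernel N d p P u x y z) \<and>
                (\<forall>n\<in>{0..N}. reproducing_kernel N d P u n x y =
                   krawtchouk_h N p n * measure_pmf.expectation \<phi> (krawtchouk N p n))))"
proof -
  note p = assms(5,6) and orth = assms(7)
  have P: "\<forall>j\<in>{1..d}. P j > 0" using assms(3) by blast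
  have d: "d \<ge> 1" using assms(2) by simp
  have Min_iff: "1 - p \<le> Min (P ` {1..d}) \<longleftrightarrow> (\<forall>j\<in>{1..d}. 1 - p \<le> P j)"
    using d by (subst Min_ge_iff) auto
  have word: "\<exists>J\<in>words N {1..d}. letter_count N J = x" if "x \<in> multinomial_support N d" for x
    using card_fiber(2)[OF that] by (auto simp: fiber_def)
  have nonneg: "triple_kernel N d p P u x y z \<ge> 0"
    if le: "1 - p \<le> Min (P ` {1..d})" and x: "x \<in> multinomial_support N d"
      and y: "y \<in> multinomial_support N d" and z: "z \<le> N" for x y z
  proof -
    obtain J where J: "J \<in> words N {1..d}" and Jx: "letter_count N J = x" using word[OF x] by blast
    \<comment> \<open>Here the bound on \<open>1 - p\<close> enters: it makes the factors at
      positions of \<open>S\<close> nonnegative.\<close>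
    have xi: "0 \<le> match_ratio P (J i) b" "(1 - p) * match_ratio P (J i) b \<le> 1" if "i < N" for i b
    proof -
      have Ji: "J i \<in> {1..d}" using wordsD[OF J that] .
      then have "P (J i) > 0" "1 - p \<le> P (J i)" using P le unfolding Min_iff by blast+
      then show "0 \<le> match_ratio P (J i) b" "(1 - p) * match_ratio P (J i) b \<le> 1"
        by (auto simp: match_ratio_def)
    qed
    show ?thesis
      unfolding Jx[symmetric] triple_kernel_average[OF orth d P p J y z]
      using xi p by (intro divide_nonneg_nonneg sum_nonneg prod_nonneg) auto
  qed
  have necessary: "1 - p \<le> P j"
    if all: "\<forall>x\<in>multinomial_support N d. \<forall>y\<in>multinomial_support N d. \<forall>z\<in>{0..N}.
        triple_kernel N d p P u x y z \<ge> 0" and j: "j \<in> {1..d}" for j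
  proof -
    \<comment> \<open>The vertex of the support with all letters equal to \<open>j\<close>: its
      fiber is a single word, so the average reduces to the sign of one product.\<close>
    define J where "J = (\<lambda>i\<in>{..<N}. j)"
    have J: "J \<in> words N {1..d}" using j by (auto simp: J_def words_def)
    let ?y = "letter_count N J"
    have y: "?y \<in> multinomial_support N d" by (rule letter_count_in_support[OF J])
    have "J' = J" if "J' \<in> fiber N d ?y" for J'
    proof -
      have J': "J' \<in> words N {1..d}" and "letter_count N J' j = N"
        using that by (auto simp: fiber_def letter_count_def J_def)
      then have "{i\<in>{..<N}. J' i = j} = {..<N}"
        by (intro card_subset_eq) (auto simp: letter_count_def)
      then have "J' i = J i" if "i \<in> {..<N}" for i using that by (auto simp: J_def)
      then show ?thesis by (rule PiE_ext[OF J'[unfolded words_def] J[unfolded words_def]])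
    qed
    then have fib: "fiber N d ?y = {J}" using J by (auto simp: fiber_def)
    \<comment> \<open>For \<open>z = 1\<close> exactly one position carries the factor that can be
      negative; the other \<open>N - 1\<close> are positive.\<close>
    have product: "(\<Prod>i<N. if i \<in> S then (1 - (1 - p) * match_ratio P (J i) (J i)) / p
                  else match_ratio P (J i) (J i))
        = (1 - (1 - p) / P j) / p * (1 / P j) ^ (N - 1)"
      if S: "S \<in> {S. S \<subseteq> {..<N} \<and> card S = 1}" for S
    proof -
      obtain a where a: "S = {a}" "a < N" using S by (auto simp: card_1_singleton_iff)
      have "(\<Prod>i<N. if i \<in> S then (1 - (1 - p) * match_ratio P (J i) (J i)) / p
                  else match_ratio P (J i) (J i))
        = (1 - (1 - p) / P j) / p * (\<Prod>i\<in>{..<N} - {a}. 1 / P j)"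
        using a by (subst prod.remove[of _ a]) (auto simp: match_ratio_def J_def intro!: prod.cong)
      then show ?thesis using a by simp
    qed
    have "0 \<le> triple_kernel N d p P u ?y ?y 1" using all y assms(1) by simp
    also have "\<dots> = (1 - (1 - p) / P j) / p * (1 / P j) ^ (N - 1)"
      unfolding triple_kernel_average[OF orth d P p J y assms(1)] fib
      using product assms(1) by (simp add: n_subsets)
    finally have "0 \<le> (1 - (1 - p) / P j) / p * (1 / P j) ^ (N - 1)" .
    moreover have "P j > 0" using P j by blast
    moreover from this have "1 / p * (1 / P j) ^ (N - 1) > 0" using p by simp
    ultimately have "0 \<le> 1 - (1 - p) / P j"
      using zero_le_mult_iff[of "1 - (1 - p) / P j" "1 / p * (1 / P j) ^ (N - 1)"] by simp
    then show ?thesis using \<open>P j > 0\<close> by (simp add: field_simps)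
  qed
  have dup: "\<exists>\<phi> :: nat pmf.
                set_pmf \<phi> \<subseteq> {0..N} \<and>
                (\<forall>z\<in>{0..N}. pmf \<phi> z =
                   real (N choose z) * p ^ z * (1 - p) ^ (N - z) * triple_kernel N d p P u x y z) \<and>
                (\<forall>n\<in>{0..N}. reproducing_kernel N d P u n x y =
                   krawtchouk_h N p n * measure_pmf.expectation \<phi> (krawtchouk N p n))"
    if le: "1 - p \<le> Min (P ` {1..d})" and x: "x \<in> multinomial_support N d"
      and y: "y \<in> multinomial_support N d" for x y
  proof -
    obtain J where J: "J \<in> words N {1..d}" and Jx: "letter_count N J = x" using word[OF x] by blast
    \<comment> \<open>The candidate mass function, set to zero beyond \<open>N\<close> so that it
      lives on all of \<open>nat\<close>.\<close>
    define f where "f z = (if z \<le> N then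
      real (N choose z) * p ^ z * (1 - p) ^ (N - z) * triple_kernel N d p P u x y z else 0)" for z
    have f0: "f z \<ge> 0" for z using nonneg[OF le x y] p by (simp add: f_def)
    have h: "krawtchouk_h N p n > 0" if "n \<le> N" for n using that p by (simp add: krawtchouk_h_def)
    \<comment> \<open>Pairing with the polynomial of degree \<open>n\<close> extracts one term of
      the triple kernel, since orthogonality removes all others.\<close>
    have expect: "(\<Sum>z=0..N. krawtchouk N p n z * f z)
        = reproducing_kernel N d P u n x y / krawtchouk_h N p n" if n: "n \<le> N" for n
    proof -
      have "(\<Sum>z=0..N. krawtchouk N p n z * f z)
          = (\<Sum>z=0..N. \<Sum>m=0..N. reproducing_kernel N d P u m x y *
              (real (N choose z) * p ^ z * (1 - p) ^ (N - z) * (krawtchouk N p n z * krawtchouk N p m z)))"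
        by (intro sum.cong refl) (simp add: f_def triple_kernel_def sum_distrib_left mult_ac)
      also have "\<dots> = (\<Sum>m=0..N. reproducing_kernel N d P u m x y *
          (\<Sum>z=0..N. real (N choose z) * p ^ z * (1 - p) ^ (N - z) * (krawtchouk N p n z * krawtchouk N p m z)))"
        by (subst sum.swap) (simp add: sum_distrib_left)
      also have "\<dots> = (\<Sum>m=0..N. if n = m then reproducing_kernel N d P u m x y / krawtchouk_h N p n else 0)"
        using n by (intro sum.cong refl) (simp add: krawtchouk_orthogonal[OF p])
      finally show ?thesis using n by simp
    qed
    \<comment> \<open>The case \<open>n = 0\<close> of \<open>expect\<close>, where the polynomial,
      the kernel and \<open>krawtchouk_h\<close> all equal one.\<close>
    have sum1: "(\<Sum>z=0..N. f z) = 1"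
      using expect[of 0] reproducing_kernel_0[OF orth d J y]
      by (simp add: krawtchouk_0 Jx krawtchouk_h_def)
    have nn: "(\<integral>\<^sup>+z. ennreal (f z) \<partial>count_space UNIV) = 1"
    proof -
      have "(\<integral>\<^sup>+z. ennreal (f z) \<partial>count_space UNIV) = (\<Sum>z\<in>{0..N}. ennreal (f z))"
        by (rule nn_integral_count_space'[OF finite_atLeastAtMost]) (auto simp: f_def)
      then show ?thesis using f0 sum1 by (simp add: sum_ennreal)
    qed
    let ?phi = "embed_pmf f"
    have pmf: "pmf ?phi z = f z" for z by (rule pmf_embed_pmf[OF f0 nn])
    have set: "set_pmf ?phi \<subseteq> {0..N}" by (auto simp: set_pmf_eq pmf f_def split: if_splits)
    have "measure_pmf.expectation ?phi (krawtchouk N p n) = (\<Sum>z=0..N. krawtchouk N p n z * f z)" for n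
      using set by (subst integral_measure_pmf_real[where A = "{0..N}"]) (auto simp: pmf)
    then have "\<forall>n\<in>{0..N}. reproducing_kernel N d P u n x y =
        krawtchouk_h N p n * measure_pmf.expectation ?phi (krawtchouk N p n)"
      using expect h by (auto simp: less_imp_neq[symmetric])
    then show ?thesis
      using set by (intro exI[of _ ?phi]) (simp add: pmf f_def)
  qed
  show ?thesis
  proof (intro conjI iffI impI ballI)
    show "1 - p \<le> Min (P ` {1..d})"
      if "\<forall>x\<in>multinomial_support N d. \<forall>y\<in>multinomial_support N d. \<forall>z\<in>{0..N}.
        triple_kernel N d p P u x y z \<ge> 0"
      unfolding Min_iff using necessary[OF that] by blast
  qed (simp add: nonneg, rule dup)
qed

end
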